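(* Let $H$ be a connected hypergraph with sink vertex $q$ and nonsink vertices $[n]$. Then a configuration $\vec{c}\in\mathbb{Z}_{\ge 0}^n$ is superstable if and only if $\vec{c}$ is an $H$-parking function.
   Context: A hypergraph $H=(V,E)$ consists of a finite vertex set $V$ and a set $E$ of subsets of $V$ of size at least $2$, called hyperedges. $H$ is connected if for any two vertices $v_1,v_2$ there is a sequence of hyperedges $(e_1,\dots,e_m)$ with $v_1\in e_1$, $v_2\in e_m$ and $e_i\cap e_{i+1}\neq\emptyset$ for all $i<m$. One vertex $q$ is the sink; the others are identified with $[n]$. A configuration is a vector $\vec{c}\in\mathbb{Z}_{\ge 0}^n$ of chips on the nonsink vertices. For nonempty $T\subseteq V$ and $v\in T$, set $\deg_T(v)=|\{e\in E: v\in e \text{ and } e\not\subseteq T\}|$. An $H$-parking function is a vector $\vec{c}\in\mathbb{Z}_{\ge 0}^n$ such that for every nonempty $T\subseteq[n]$ there is $i\in T$ with $c_i<\deg_T(i)$. A firing choice at $v\in[n]$ is a choice, for each hyperedge $e\ni v$, of a vertex $w\in e$ with $w\ne v$; firing $v$ with this choice removes one chip from $v$ for each hyperedge $e\ni v$ and gives it to the vertex chosen for $e$ (chips sent to $q$ are discarded). A firing choice for a set $T\subseteq V\setminus q$ is a firing choice for each $v\in T$, and firing $T$ performs all these moves simultaneously. It is cancellative if for every hyperedge $e\subseteq T$ the map sending each $v\in e$ to the vertex chosen by $v$ for $e$ is a (fixed-point-free) permutation of $e$. A nonempty $T\subseteq V\setminus q$ is ready to fire if every cancellative firing choice for $T$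 results in a configuration with all coordinates nonnegative. A configuration $\vec{c}$ is superstable if no nonempty $T\subseteq V\setminus q$ is ready to fire. *)

theory Defs
  imports Main
begin

text \<open>
  A hypergraph is given by a vertex set \<open>V\<close> and an edge set \<open>E\<close>; with a sink \<open>q \<in> V\<close>, the
  nonsink vertices \<open>V - {q}\<close> play the role of $[n]$. A configuration is a function
  \<open>c :: 'a \<Rightarrow> nat\<close>, of which only the values on \<open>V - {q}\<close> are ever inspected.
\<close>

definition hypergraph :: "'a set \<Rightarrow> 'a set set \<Rightarrow> bool" where
  "hypergraph V E \<longleftrightarrow> finite V \<and> (\<forall>e\<in>E. e \<subseteq> V \<and> card e \<ge> 2)"

text \<open>
  ``Any two vertices'' means two distinct vertices, so a single vertex without hyperedges
  is connected.
\<close>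

definition hypergraph_connected :: "'a set \<Rightarrow> 'a set set \<Rightarrow> bool" where
  "hypergraph_connected V E \<longleftrightarrow>
     (\<forall>v\<^sub>1\<in>V. \<forall>v\<^sub>2\<in>V. v\<^sub>1 \<noteq> v\<^sub>2 \<longrightarrow>
        (\<exists>es. es \<noteq> [] \<and> set es \<subseteq> E \<and> v\<^sub>1 \<in> hd es \<and> v\<^sub>2 \<in> last es \<and>
              (\<forall>i. Suc i < length es \<longrightarrow> es ! i \<inter> es ! Suc i \<noteq> {})))"

definition hdeg :: "'a set set \<Rightarrow> 'a set \<Rightarrow> 'a \<Rightarrow> nat" where
  "hdeg E T v = card {e \<in> E. v \<in> e \<and> \<not> e \<subseteq> T}"

definition hypergraph_parking :: "'a set \<Rightarrow> 'a set set \<Rightarrow> 'a \<Rightarrow> ('a \<Rightarrow> nat) \<Rightarrow> bool" where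
  "hypergraph_parking V E q c \<longleftrightarrow>
     (\<forall>T. T \<noteq> {} \<and> T \<subseteq> V - {q} \<longrightarrow> (\<exists>i\<in>T. c i < hdeg E T i))"

text \<open>
  A firing choice is a function \<open>w\<close>, where \<open>w v e\<close> is the vertex to which \<open>v\<close> sends a chip
  along \<open>e\<close>; its values at other pairs \<open>v\<close>, \<open>e\<close> are irrelevant.
\<close>

definition vertex_firing_choice :: "'a set set \<Rightarrow> 'a \<Rightarrow> ('a set \<Rightarrow> 'a) \<Rightarrow> bool" where
  "vertex_firing_choice E v f \<longleftrightarrow> (\<forall>e\<in>E. v \<in> e \<longrightarrow> f e \<in> e \<and> f e \<noteq> v)"

definition firing_choice :: "'a set set \<Rightarrow> 'a set \<Rightarrow> ('a \<Rightarrow> 'a set \<Rightarrow> 'a) \<Rightarrow> bool" where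
  "firing_choice E T w \<longleftrightarrow> (\<forall>v\<in>T. vertex_firing_choice E v (w v))"

text \<open>
  The net change in the number of chips at \<open>u\<close> caused by firing \<open>v\<close>: every hyperedge
  containing \<open>v\<close> moves one chip from \<open>v\<close> to the chosen vertex.
\<close>

definition vertex_fire_change :: "'a set set \<Rightarrow> 'a \<Rightarrow> ('a set \<Rightarrow> 'a) \<Rightarrow> 'a \<Rightarrow> int" where
  "vertex_fire_change E v f u =
     (\<Sum>e \<in> {e \<in> E. v \<in> e}. of_bool (f e = u) - of_bool (v = u))"

text \<open>
  The result of firing a set is integer-valued since entries may become negative. It is
  only read off at nonsink vertices, which is how chips sent to the sink are discarded.
\<close>

definition fire_set ::
  "'a set set \<Rightarrow> 'a set \<Rightarrow> ('a \<Rightarrow> 'a set \<Rightarrow> 'a) \<Rightarrow> ('a \<Rightarrow> nat) \<Rightarrow> 'a \<Rightarrow> int" where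
  "fire_set E T w c u = int (c u) + (\<Sum>v\<in>T. vertex_fire_change E v (w v) u)"

text \<open>Fixed-point freeness of the permutation is part of being a firing choice.\<close>

definition cancellative :: "'a set set \<Rightarrow> 'a set \<Rightarrow> ('a \<Rightarrow> 'a set \<Rightarrow> 'a) \<Rightarrow> bool" where
  "cancellative E T w \<longleftrightarrow> (\<forall>e\<in>E. e \<subseteq> T \<longrightarrow> bij_betw (\<lambda>v. w v e) e e)"

definition ready_to_fire ::
  "'a set \<Rightarrow> 'a set set \<Rightarrow> 'a \<Rightarrow> ('a \<Rightarrow> nat) \<Rightarrow> 'a set \<Rightarrow> bool" where
  "ready_to_fire V E q c T \<longleftrightarrow>
     T \<noteq> {} \<and> T \<subseteq> V - {q} \<and>
     (\<forall>w. firing_choice E T w \<and> cancellative E T w \<longrightarrow>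
          (\<forall>u \<in> V - {q}. fire_set E T w c u \<ge> 0))"

definition superstable :: "'a set \<Rightarrow> 'a set set \<Rightarrow> 'a \<Rightarrow> ('a \<Rightarrow> nat) \<Rightarrow> bool" where
  "superstable V E q c \<longleftrightarrow> (\<nexists>T. T \<noteq> {} \<and> T \<subseteq> V - {q} \<and> ready_to_fire V E q c T)"

end

theory Submission
  imports Defs
begin

text \<open>
  Both properties quantify over nonempty sets \<open>T\<close> of nonsink vertices, and the theorem holds set by
  set: \<open>T\<close> is ready to fire exactly when every \<open>i \<in> T\<close> has at least \<open>hdeg E T i\<close> chips, that is,
  exactly when \<open>T\<close> violates the parking condition.

  To see this, count the chips moved along each hyperedge separately. Along a hyperedge inside \<open>T\<close>
  a cancellative choice is a permutation, so every vertex gets back the chip it sends. Along any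
  other hyperedge \<open>e\<close> a vertex \<open>u \<in> T \<inter> e\<close> sends one chip and perhaps receives some. Hence firing
  costs \<open>u\<close> at most \<open>hdeg E T u\<close> chips (\<open>fire_set_lower_bound\<close>). A single cancellative choice makes
  this bound sharp at all \<open>u \<in> T\<close> simultaneously: along the hyperedges not inside \<open>T\<close>, let all chips
  leave \<open>T\<close>, and along the hyperedges inside \<open>T\<close> use any fixed-point-free permutation
  (\<open>outward_firing_choice\<close>).
\<close>

lemma derangement_exists:
  fixes A :: "'a set"
  assumes "finite A" and "card A \<ge> 2"
  shows "\<exists>p. bij_betw p A A \<and> (\<forall>x\<in>A. p x \<noteq> x)"
proof -
  let ?n = "card A"
  \<comment> \<open>Number the elements and shift the numbers cyclically.\<close>
  let ?s = "\<lambda>i. if Suc i = ?n then 0 else Suc i"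
  obtain h where h: "bij_betw h A {0..<?n}"
    using ex_bij_betw_finite_nat[OF assms(1)] by blast
  have inj: "inj_on ?s {0..<?n}"
    by (auto simp: inj_on_def split: if_splits)
  have "?s ` {0..<?n} \<subseteq> {0..<?n}"
    using assms(2) by auto
  then have s: "bij_betw ?s {0..<?n} {0..<?n}"
    using inj endo_inj_surj[of "{0..<?n}" ?s] by (simp add: bij_betw_def)
  define p where "p = inv_into A h \<circ> (?s \<circ> h)"
  have "bij_betw p A A"
    unfolding p_def using bij_betw_trans[OF bij_betw_trans[OF h s] bij_betw_inv_into[OF h]] .
  moreover have "p x \<noteq> x" if "x \<in> A" for x
  proof
    assume "p x = x"
    have "h x \<in> {0..<?n}"
      using h that by (rule bij_betwE[THEN bspec])
    then have "?s (h x) \<in> {0..<?n}"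
      using s by (blast dest: bij_betwE)
    then have "h (p x) = ?s (h x)"
      unfolding p_def using bij_betw_inv_into_right[OF h] by simp
    with \<open>p x = x\<close> have "h x = ?s (h x)"
      by simp
    then show False
      using assms(2) by (simp split: if_splits)
  qed
  ultimately show ?thesis
    by blast
qed

lemma hypergraph_finite_edges:
  assumes "hypergraph V E"
  shows "finite E" and "e \<in> E \<Longrightarrow> finite e"
proof -
  have "E \<subseteq> Pow V" "finite V"
    using assms by (auto simp: hypergraph_def)
  then show "finite E" "e \<in> E \<Longrightarrow> finite e"
    by (auto intro: finite_subset)
qed

definition edge_fire_change :: "'a set \<Rightarrow> ('a \<Rightarrow> 'a set \<Rightarrow> 'a) \<Rightarrow> 'a set \<Rightarrow> 'a \<Rightarrow> int" where
  "edge_fire_change T w e u = (\<Sum>v\<in>T \<inter> e. of_bool (w v e = u) - of_bool (v = u))"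

text \<open>
  Exchanging the sums over vertices and hyperedges isolates the hyperedges inside \<open>T\<close>, which is
  where a cancellative choice has structure.
\<close>

lemma fire_set_by_edges:
  assumes "finite E" and "finite T"
  shows "fire_set E T w c u = int (c u) + (\<Sum>e\<in>E. edge_fire_change T w e u)"
proof -
  have "(\<Sum>v\<in>T. vertex_fire_change E v (w v) u) = (\<Sum>e\<in>E. edge_fire_change T w e u)"
    using sum.swap_restrict[OF assms(2,1),
        of "\<lambda>v e. of_bool (w v e = u) - of_bool (v = u)" "\<lambda>v e. v \<in> e"]
    by (simp add: vertex_fire_change_def edge_fire_change_def Int_def)
  then show ?thesis
    by (simp add: fire_set_def)
qed

lemma edge_fire_change_eq:
  assumes "finite e"
  shows "edge_fire_change T w e u =
    int (card {v \<in> T \<inter> e. w v e = u}) - of_bool (u \<in> T \<inter> e)"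
proof -
  have "(\<Sum>v\<in>T \<inter> e. of_bool (v = u)) = (of_bool (u \<in> T \<inter> e) :: int)"
    using assms by (simp add: of_bool_def)
  moreover have "(\<Sum>v\<in>T \<inter> e. of_bool (w v e = u)) = int (card {v \<in> T \<inter> e. w v e = u})"
    using assms by (simp add: Int_def)
  ultimately show ?thesis
    by (simp add: edge_fire_change_def sum_subtractf)
qed

lemma edge_fire_change_inside:
  assumes "finite e" and "e \<subseteq> T" and "bij_betw (\<lambda>v. w v e) e e"
  shows "edge_fire_change T w e u = 0"
proof -
  have "(\<Sum>v\<in>e. of_bool (w v e = u)) = (\<Sum>v\<in>e. of_bool (v = u) :: int)"
    using sum.reindex_bij_betw[OF assms(3), of "\<lambda>v. of_bool (v = u)"] .
  moreover have "T \<inter> e = e"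
    using assms(2) by blast
  ultimately show ?thesis
    by (simp add: edge_fire_change_def sum_subtractf)
qed

lemma hdeg_as_sum:
  assumes "finite E"
  shows "int (hdeg E T u) = (\<Sum>e\<in>E. of_bool (u \<in> e \<and> \<not> e \<subseteq> T))"
  using assms by (simp add: hdeg_def Int_def)

text \<open>
  Hyperedges inside \<open>T\<close> cause no change, because the choice is cancellative. Dropping the chips
  received along the others leaves only the one chip that \<open>u \<in> T\<close> sends along each of them.
\<close>

lemma fire_set_lower_bound:
  assumes "finite E" and "finite T" and "\<And>e. e \<in> E \<Longrightarrow> finite e"
    and "cancellative E T w"
  shows "fire_set E T w c u \<ge> int (c u) - (if u \<in> T then int (hdeg E T u) else 0)"
proof -
  have "edge_fire_change T w e u \<ge> - of_bool (u \<in> T \<and> u \<in> e \<and> \<not> e \<subseteq> T)" if "e \<in> E" for e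
  proof (cases "e \<subseteq> T")
    case True
    then show ?thesis
      using assms(3,4) that by (simp add: edge_fire_change_inside cancellative_def)
  next
    case False
    then show ?thesis
      using assms(3) that by (simp add: edge_fire_change_eq)
  qed
  then have "(\<Sum>e\<in>E. edge_fire_change T w e u) \<ge> (\<Sum>e\<in>E. - of_bool (u \<in> T \<and> u \<in> e \<and> \<not> e \<subseteq> T))"
    by (rule sum_mono)
  moreover have "(\<Sum>e\<in>E. - of_bool (u \<in> T \<and> u \<in> e \<and> \<not> e \<subseteq> T)) =
      - (if u \<in> T then int (hdeg E T u) else 0)"
    unfolding hdeg_as_sum[OF assms(1)] by (simp add: sum_negf del: sum_of_bool_eq)
  ultimately show ?thesis
    using assms(1,2) by (simp add: fire_set_by_edges)
qed

text \<open>
  Hyperedges have at least two vertices, so those inside \<open>T\<close> admit derangements; those not inside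
  \<open>T\<close> have a vertex outside \<open>T\<close> to which all their chips can be sent.
\<close>

lemma outward_firing_choice:
  assumes "\<And>e. e \<in> E \<Longrightarrow> finite e \<and> card e \<ge> 2"
  obtains w where "firing_choice E T w" and "cancellative E T w"
    and "\<And>v e. e \<in> E \<Longrightarrow> \<not> e \<subseteq> T \<Longrightarrow> w v e \<in> e - T"
proof -
  have "\<forall>e\<in>E. \<exists>p. bij_betw p e e \<and> (\<forall>x\<in>e. p x \<noteq> x)"
    using assms derangement_exists by blast
  then obtain p where p: "\<And>e. e \<in> E \<Longrightarrow> bij_betw (p e) e e"
      "\<And>e x. e \<in> E \<Longrightarrow> x \<in> e \<Longrightarrow> p e x \<noteq> x"
    by metis
  define w where "w = (\<lambda>v e. if e \<subseteq> T then p e v else (SOME x. x \<in> e - T))"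
  have out: "w v e \<in> e - T" if "\<not> e \<subseteq> T" for v e
    using that someI_ex[of "\<lambda>x. x \<in> e - T"] by (auto simp: w_def)
  have perm: "w v e = p e v" if "e \<subseteq> T" for v e
    using that by (simp add: w_def)
  have "w v e \<in> e \<and> w v e \<noteq> v" if "v \<in> T" "e \<in> E" "v \<in> e" for v e
  proof (cases "e \<subseteq> T")
    case True
    then show ?thesis
      using p[OF that(2)] that(3) by (auto simp: perm dest: bij_betwE)
  next
    case False
    then show ?thesis
      using out[of e v] that(1) by auto
  qed
  then have "firing_choice E T w"
    by (simp add: firing_choice_def vertex_firing_choice_def)
  moreover have "cancellative E T w"
    using p(1) by (simp add: cancellative_def perm)
  ultimately show ?thesis
    using that out by blast
qed

text \<open>
  The only slack in \<open>fire_set_lower_bound\<close> is the chips that \<open>u\<close> receives along hyperedges not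
  inside \<open>T\<close>; there are none if those chips all leave \<open>T\<close>.
\<close>

lemma fire_set_outward:
  assumes "finite E" and "finite T" and "\<And>e. e \<in> E \<Longrightarrow> finite e"
    and "cancellative E T w"
    and "\<And>v e. e \<in> E \<Longrightarrow> \<not> e \<subseteq> T \<Longrightarrow> w v e \<in> e - T"
    and "u \<in> T"
  shows "fire_set E T w c u = int (c u) - int (hdeg E T u)"
proof -
  have "edge_fire_change T w e u = - of_bool (u \<in> e \<and> \<not> e \<subseteq> T)" if "e \<in> E" for e
  proof (cases "e \<subseteq> T")
    case True
    then show ?thesis
      using assms(3,4) that by (simp add: edge_fire_change_inside cancellative_def)
  next
    case False
    then have "{v \<in> T \<inter> e. w v e = u} = {}"
      using assms(5)[OF that] assms(6) by blast
    then show ?thesis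
      using False assms(3)[OF that] assms(6) by (simp only: edge_fire_change_eq) simp
  qed
  then have "(\<Sum>e\<in>E. edge_fire_change T w e u) = - int (hdeg E T u)"
    unfolding hdeg_as_sum[OF assms(1)] by (simp add: sum_negf del: sum_of_bool_eq)
  then show ?thesis
    using assms(1,2) by (simp add: fire_set_by_edges)
qed

lemma ready_to_fire_iff_hdeg_le:
  assumes "hypergraph V E"
  shows "ready_to_fire V E q c T \<longleftrightarrow>
    T \<noteq> {} \<and> T \<subseteq> V - {q} \<and> (\<forall>i\<in>T. hdeg E T i \<le> c i)"
proof (cases "T \<subseteq> V - {q}")
  case True
  note fin = hypergraph_finite_edges[OF assms]
  have T: "finite T"
    using assms True by (auto simp: hypergraph_def intro: finite_subset)
  obtain w where w: "firing_choice E T w" "cancellative E T w"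
      "\<And>v e. e \<in> E \<Longrightarrow> \<not> e \<subseteq> T \<Longrightarrow> w v e \<in> e - T"
    using outward_firing_choice[of E T] assms fin(2) unfolding hypergraph_def by blast
  have "hdeg E T i \<le> c i" if "ready_to_fire V E q c T" "i \<in> T" for i
  proof -
    have "fire_set E T w c i \<ge> 0"
      using that True w(1,2) by (auto simp: ready_to_fire_def)
    then show ?thesis
      using fire_set_outward[OF fin(1) T fin(2) w(2,3) that(2), of c] by simp
  qed
  moreover have "fire_set E T w' c u \<ge> 0"
    if "\<forall>i\<in>T. hdeg E T i \<le> c i" "cancellative E T w'" for w' u
    using fire_set_lower_bound[OF fin(1) T fin(2) that(2), of c u] that(1)
    by (cases "u \<in> T") force+
  ultimately show ?thesis
    using True by (auto simp: ready_to_fire_def)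
qed (simp add: ready_to_fire_def)

theorem corollary5p10:
  fixes V :: "'a set" and E :: "'a set set" and q :: 'a and c :: "'a \<Rightarrow> nat"
  assumes "hypergraph V E"
    and "hypergraph_connected V E"
    and "q \<in> V"
  shows "superstable V E q c \<longleftrightarrow> hypergraph_parking V E q c"
  unfolding superstable_def hypergraph_parking_def ready_to_fire_iff_hdeg_le[OF assms(1)]
  by (meson not_le)

end
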